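(* Consider the adjacency-list model augmented with $\texttt{JUMP}$ and exactly one of $\texttt{IN-SORTED}$ and $\texttt{ADJ}$ (not both). For any $n$ and $m$ with $n\le m\le n^2$, there exists a directed graph $G=(V,E)$ with $\Theta(n)$ nodes and $\Theta(m)$ edges such that for any algorithm solving the single-node problem, the expected running time on $G$, averaged over all targets $t\in V$, is $\Omega(m^{1/2})$.
   Context: Fix a constant $\alpha\in(0,1)$. For a directed graph $G=(V,E)$ with $n=|V|$, an $\alpha$-discounted random walk from $s$: at each step, with probability $\alpha$ it terminates at the current node, otherwise it moves to a uniformly random out-neighbor of the current node. $\pi(s,t)$ is the probability that such a walk from $s$ terminates at $t$, and $\pi(t)=\frac1n\sum_{s\in V}\pi(s,t)$. Adjacency-list model: an algorithm accesses $G$ only through constant-time queries $\texttt{DEG-IN}(u)$, $\texttt{DEG-OUT}(u)$ (in-/out-degree of $u$), $\texttt{IN}(u,i)$, $\texttt{OUT}(u,i)$ ($i$-th in-/out-neighbor of $u$). Additional queries: $\texttt{ADJ}(u,v)$ returns whether $(u,v)\in E$; $\texttt{IN-SORTED}(u,i)$ returns the $i$-th in-neighbor of $u$ when in-neighbors are sorted by out-degree; $\texttt{JUMP}()$ returns a uniformly random node of $V$. Single-node problem: given $G$ (via queries) and a target $t\in V$, output $\hat\pi(t)$ with $\Pr\{|\hat\pi(t)-\pi(t)|\ge\varepsilon\pi(t)\}\le p_f$, where $\varepsilon,p_f$ are fixed small constants; an algorithm solves the problem if this holds for every input. *)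

theory Defs
  imports "HOL-Probability.Probability" "Graph_Theory.Pair_Digraph"
begin

section \<open>Directed graphs and discounted random walks\<close>

text \<open>
  Input graphs are finite and nonempty, without parallel edges; loops are allowed. Every node has an
  out-neighbour, since otherwise the walk's move to a random out-neighbour is undefined.
\<close>

definition input_graph :: "nat pair_pre_digraph \<Rightarrow> bool" where
  "input_graph G \<longleftrightarrow> pair_fin_digraph G \<and> pverts G \<noteq> {} \<and>
     (\<forall>u\<in>pverts G. parcs G `` {u} \<noteq> {})"

datatype walk_state = Walking nat | Stopped nat

primrec walk_step :: "real \<Rightarrow> nat pair_pre_digraph \<Rightarrow> walk_state \<Rightarrow> walk_state pmf" where
  "walk_step \<alpha> G (Walking u) =
     bind_pmf (bernoulli_pmf \<alpha>) (\<lambda>stop. if stop then return_pmf (Stopped u)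
       else map_pmf Walking (pmf_of_set (parcs G `` {u})))"
| "walk_step \<alpha> G (Stopped u) = return_pmf (Stopped u)"

primrec walk :: "real \<Rightarrow> nat pair_pre_digraph \<Rightarrow> nat \<Rightarrow> nat \<Rightarrow> walk_state pmf" where
  "walk \<alpha> G s 0 = return_pmf (Walking s)"
| "walk \<alpha> G s (Suc k) = bind_pmf (walk \<alpha> G s k) (walk_step \<alpha> G)"

text \<open>
  The events ``stopped at \<open>t\<close> within \<open>k\<close> steps'' increase with \<open>k\<close>, so the probability of ever
  terminating at \<open>t\<close> is the supremum of their probabilities.
\<close>

definition ppr :: "real \<Rightarrow> nat pair_pre_digraph \<Rightarrow> nat \<Rightarrow> nat \<Rightarrow> real" where
  "ppr \<alpha> G s t = (SUP k. pmf (walk \<alpha> G s k) (Stopped t))"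

definition pagerank :: "real \<Rightarrow> nat pair_pre_digraph \<Rightarrow> nat \<Rightarrow> real" where
  "pagerank \<alpha> G t = (\<Sum>s\<in>pverts G. ppr \<alpha> G s t) / real (card (pverts G))"


section \<open>Query access\<close>

record adj_lists =
  in_list :: "nat \<Rightarrow> nat list"
  out_list :: "nat \<Rightarrow> nat list"
  in_sorted_list :: "nat \<Rightarrow> nat list"

text \<open>Adjacency lists are in arbitrary order; in the sorted lists, ties are broken arbitrarily.\<close>

definition adj_lists_of :: "nat pair_pre_digraph \<Rightarrow> adj_lists \<Rightarrow> bool" where
  "adj_lists_of G L \<longleftrightarrow> (\<forall>u\<in>pverts G.
     distinct (in_list L u) \<and> set (in_list L u) = (parcs G)\<inverse> `` {u} \<and>
     distinct (out_list L u) \<and> set (out_list L u) = parcs G `` {u} \<and>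
     distinct (in_sorted_list L u) \<and> set (in_sorted_list L u) = (parcs G)\<inverse> `` {u} \<and>
     sorted (map (out_degree (with_proj G)) (in_sorted_list L u)))"

datatype query =
    Deg_In nat | Deg_Out nat | In nat nat | Out nat nat
  | Adj nat nat | In_Sorted nat nat | Jump

text \<open>\<open>Invalid\<close> answers queries about non-nodes or with an index out of range; \<open>Rand x\<close> is not
  an answer to a query but the outcome of an internal random draw.\<close>

datatype reply = Num nat | Node nat | Truth bool | Invalid | Rand nat

definition nth_reply :: "nat list \<Rightarrow> nat \<Rightarrow> reply" where
  "nth_reply xs i = (if 1 \<le> i \<and> i \<le> length xs then Node (xs ! (i - 1)) else Invalid)"

fun answer :: "nat pair_pre_digraph \<Rightarrow> adj_lists \<Rightarrow> query \<Rightarrow> reply pmf" where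
  "answer G L (Deg_In u) =
     return_pmf (if u \<in> pverts G then Num (in_degree (with_proj G) u) else Invalid)"
| "answer G L (Deg_Out u) =
     return_pmf (if u \<in> pverts G then Num (out_degree (with_proj G) u) else Invalid)"
| "answer G L (In u i) =
     return_pmf (if u \<in> pverts G then nth_reply (in_list L u) i else Invalid)"
| "answer G L (Out u i) =
     return_pmf (if u \<in> pverts G then nth_reply (out_list L u) i else Invalid)"
| "answer G L (Adj u v) =
     return_pmf (if u \<in> pverts G \<and> v \<in> pverts G then Truth ((u, v) \<in> parcs G) else Invalid)"
| "answer G L (In_Sorted u i) =
     return_pmf (if u \<in> pverts G then nth_reply (in_sorted_list L u) i else Invalid)"
| "answer G L Jump = map_pmf Node (pmf_of_set (pverts G))"


section \<open>Algorithms and running time\<close>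

text \<open>
  An algorithm is given the number of nodes and the target, and chooses its next action from the
  replies received so far. A \<open>Compute D\<close> step draws an internal random value from \<open>D\<close>; with a point
  distribution it is a step of deterministic computation. Every query and every \<open>Compute\<close> step takes
  one unit of time, so the running time is the number of replies received before \<open>Output\<close>.
\<close>

datatype action = Query query | Compute "nat pmf" | Output real

type_synonym algorithm = "nat \<Rightarrow> nat \<Rightarrow> reply list \<Rightarrow> action"

primrec run :: "nat pair_pre_digraph \<Rightarrow> adj_lists \<Rightarrow> algorithm \<Rightarrow> nat \<Rightarrow> nat \<Rightarrow> reply list pmf" where
  "run G L A t 0 = return_pmf []"
| "run G L A t (Suc k) = bind_pmf (run G L A t k) (\<lambda>h.
     case A (card (pverts G)) t h of
       Query q \<Rightarrow> map_pmf (\<lambda>r. h @ [r]) (answer G L q)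
     | Compute D \<Rightarrow> map_pmf (\<lambda>x. h @ [Rand x]) D
     | Output x \<Rightarrow> return_pmf h)"

text \<open>\<open>run G L A t k\<close> is the history after at most \<open>k\<close> steps, so its length is the running time
  capped at \<open>k\<close>. The supremum is \<open>\<infinity>\<close> if the algorithm fails to halt with positive probability.\<close>

definition expected_time ::
    "nat pair_pre_digraph \<Rightarrow> adj_lists \<Rightarrow> algorithm \<Rightarrow> nat \<Rightarrow> ennreal" where
  "expected_time G L A t =
     (SUP k. \<integral>\<^sup>+ h. of_nat (length h) \<partial>measure_pmf (run G L A t k))"

definition average_time :: "nat pair_pre_digraph \<Rightarrow> adj_lists \<Rightarrow> algorithm \<Rightarrow> ennreal" where
  "average_time G L A =
     (\<Sum>t\<in>pverts G. expected_time G L A t) / of_nat (card (pverts G))"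

text \<open>The probability of halting with relative error below \<open>\<epsilon>\<close>; not halting counts as failure.\<close>

definition success_prob ::
    "real \<Rightarrow> real \<Rightarrow> nat pair_pre_digraph \<Rightarrow> adj_lists \<Rightarrow> algorithm \<Rightarrow> nat \<Rightarrow> real" where
  "success_prob \<alpha> \<epsilon> G L A t =
     (SUP k. measure_pmf.prob (run G L A t k)
        {h. \<exists>x. A (card (pverts G)) t h = Output x \<and>
                \<bar>x - pagerank \<alpha> G t\<bar> < \<epsilon> * pagerank \<alpha> G t})"

datatype extra_query = With_In_Sorted | With_Adj

fun allowed :: "extra_query \<Rightarrow> query \<Rightarrow> bool" where
  "allowed X (Adj u v) \<longleftrightarrow> X = With_Adj"
| "allowed X (In_Sorted u i) \<longleftrightarrow> X = With_In_Sorted"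
| "allowed X _ \<longleftrightarrow> True"

definition in_model :: "extra_query \<Rightarrow> algorithm \<Rightarrow> bool" where
  "in_model X A \<longleftrightarrow> (\<forall>n t h q. A n t h = Query q \<longrightarrow> allowed X q)"

definition solves_single_node :: "real \<Rightarrow> real \<Rightarrow> real \<Rightarrow> algorithm \<Rightarrow> bool" where
  "solves_single_node \<alpha> \<epsilon> p\<^sub>f A \<longleftrightarrow>
     (\<forall>G L t. input_graph G \<longrightarrow> adj_lists_of G L \<longrightarrow> t \<in> pverts G \<longrightarrow>
        1 - success_prob \<alpha> \<epsilon> G L A t \<le> p\<^sub>f)"

end

theory Submission
  imports Defs
begin

text \<open>
  Let \<open>k \<approx> \<surd>m\<close> and \<open>D \<approx> n / k\<close>. The hard graph has \<open>k\<close> feeders joined completely to \<open>k\<close> hubs, each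
  hub pointing to \<open>D\<close> targets, and, in a separate component, \<open>k * K * D\<close> sources whose weight flows
  through middle nodes into \<open>k\<close> sinks. For a target below hub \<open>h\<close>, exchange the heads of the arc
  into sink \<open>j\<close> and of the arc from feeder \<open>l\<close> to \<open>h\<close>. This keeps all degrees but raises the PageRank of the
  target by a constant factor, so an algorithm has to tell the hard graph from each of the \<open>k\<^sup>2\<close>
  exchanged graphs. Every query has a different answer on at most \<open>2 k\<close> of them. Averaging the total
  variation distance of the run on the hard graph to the runs on the exchanged graphs bounds the
  expected time below by \<open>(1 - 2 p\<^sub>f) k / 2\<close>, and the targets make up a constant fraction of
  all nodes.
\<close>

section \<open>Runs on indistinguishable inputs\<close>

definition run_step :: "nat pair_pre_digraph \<Rightarrow> adj_lists \<Rightarrow> algorithm \<Rightarrow> nat \<Rightarrow> reply list \<Rightarrow> reply list pmf" where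
  "run_step G L A t h = (case A (card (pverts G)) t h of
       Query q \<Rightarrow> map_pmf (\<lambda>r. h @ [r]) (answer G L q)
     | Compute D \<Rightarrow> map_pmf (\<lambda>x. h @ [Rand x]) D
     | Output x \<Rightarrow> return_pmf h)"

lemma run_Suc: "run G L A t (Suc k) = bind_pmf (run G L A t k) (run_step G L A t)"
  by (simp add: run_step_def[abs_def])

declare run.simps(2) [simp del]

section \<open>Running time as a sum of survival probabilities\<close>

definition running :: "nat pair_pre_digraph \<Rightarrow> algorithm \<Rightarrow> nat \<Rightarrow> reply list set" where
  "running G A t = {h. \<forall>x. A (card (pverts G)) t h \<noteq> Output x}"

lemma nn_integral_length_run_step:
  "(\<integral>\<^sup>+ h'. of_nat (length h') \<partial>measure_pmf (run_step G L A t h))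
     = of_nat (length h) + indicator (running G A t) h"
  by (auto simp: run_step_def running_def nn_integral_return split: action.split)

text \<open>Step \<open>r\<close> lengthens the history by exactly one reply if the algorithm is
  still running and leaves it alone otherwise, so the expected length telescopes into survival
  probabilities.\<close>

lemma nn_integral_length_run:
  "(\<integral>\<^sup>+ h. of_nat (length h) \<partial>measure_pmf (run G L A t k))
     = (\<Sum>r<k. emeasure (measure_pmf (run G L A t r)) (running G A t))"
proof (induction k)
  case 0
  then show ?case by (simp add: nn_integral_return)
next
  case (Suc k)
  have "(\<integral>\<^sup>+ h. of_nat (length h) \<partial>measure_pmf (run G L A t (Suc k)))
    = (\<integral>\<^sup>+ h. of_nat (length h) + indicator (running G A t) h \<partial>measure_pmf (run G L A t k))"
    by (simp add: run_Suc nn_integral_bind_pmf nn_integral_length_run_step)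
  also have "\<dots> = (\<integral>\<^sup>+ h. of_nat (length h) \<partial>measure_pmf (run G L A t k))
     + emeasure (measure_pmf (run G L A t k)) (running G A t)"
    by (subst nn_integral_add) auto
  finally show ?case using Suc.IH by simp
qed

lemma expected_time_eq_suminf:
  "expected_time G L A t = (\<Sum>r. emeasure (measure_pmf (run G L A t r)) (running G A t))"
  by (simp add: expected_time_def nn_integral_length_run suminf_eq_SUP)

section \<open>Comparing the runs on two inputs\<close>

definition distinguishing ::
    "nat pair_pre_digraph \<Rightarrow> adj_lists \<Rightarrow> nat pair_pre_digraph \<Rightarrow> adj_lists \<Rightarrow> algorithm \<Rightarrow> nat \<Rightarrow> reply list set" where
  "distinguishing G L G' L' A t =
     {h. \<exists>q. A (card (pverts G)) t h = Query q \<and> answer G' L' q \<noteq> answer G L q}"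

lemma run_step_eq:
  assumes "card (pverts G') = card (pverts G)" "h \<notin> distinguishing G L G' L' A t"
  shows "run_step G' L' A t h = run_step G L A t h"
  using assms by (auto simp: run_step_def distinguishing_def split: action.split)

text \<open>The induction peels off the last step and replaces \<open>f\<close> by its conditional
  expectation given the earlier history. That function need not be an indicator even if
  \<open>f\<close> is one, which is why \<open>f\<close> ranges over all functions bounded by 1. On
  a distinguishing history the two expectations differ by at most 1, elsewhere they agree. All error
  terms are measured under the run on \<open>G\<close> alone.\<close>

lemma nn_integral_run_le:
  fixes f :: "reply list \<Rightarrow> ennreal"
  assumes same: "card (pverts G') = card (pverts G)" and "\<And>h. f h \<le> 1"
  shows "(\<integral>\<^sup>+ h. f h \<partial>measure_pmf (run G L A t k)) \<le> (\<integral>\<^sup>+ h. f h \<partial>measure_pmf (run G' L' A t k))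
    + (\<Sum>r<k. emeasure (measure_pmf (run G L A t r)) (distinguishing G L G' L' A t))"
  using assms(2)
proof (induction k arbitrary: f)
  case 0
  then show ?case by simp
next
  case (Suc k)
  let ?B = "distinguishing G L G' L' A t"
  define F where "F h = (\<integral>\<^sup>+ h'. f h' \<partial>measure_pmf (run_step G L A t h))" for h
  define F' where "F' h = (\<integral>\<^sup>+ h'. f h' \<partial>measure_pmf (run_step G' L' A t h))" for h
  have le1: "F h \<le> 1" "F' h \<le> 1" for h
    using nn_integral_mono[of "measure_pmf _" f "\<lambda>_. 1"] Suc.prems
    by (auto simp: F_def F'_def measure_pmf.emeasure_space_1[simplified])
  have "F h \<le> F' h + indicator ?B h" for h
    using le1[of h] run_step_eq[OF same, of h L L' A t]
    by (cases "h \<in> ?B") (auto simp: F_def F'_def add_increasing)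
  then have "(\<integral>\<^sup>+ h. F h \<partial>measure_pmf (run G L A t k))
      \<le> (\<integral>\<^sup>+ h. F' h + indicator ?B h \<partial>measure_pmf (run G L A t k))"
    by (intro nn_integral_mono) auto
  also have "\<dots> = (\<integral>\<^sup>+ h. F' h \<partial>measure_pmf (run G L A t k))
      + emeasure (measure_pmf (run G L A t k)) ?B"
    by (subst nn_integral_add) auto
  also have "\<dots> \<le> ((\<integral>\<^sup>+ h. F' h \<partial>measure_pmf (run G' L' A t k))
      + (\<Sum>r<k. emeasure (measure_pmf (run G L A t r)) ?B)) + emeasure (measure_pmf (run G L A t k)) ?B"
    by (intro add_right_mono Suc.IH le1)
  finally show ?case
    by (simp add: run_Suc nn_integral_bind_pmf F_def[symmetric] F'_def[symmetric] add.assoc)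
qed

lemma emeasure_run_le:
  assumes "card (pverts G') = card (pverts G)"
  shows "emeasure (measure_pmf (run G L A t k)) S \<le> emeasure (measure_pmf (run G' L' A t k)) S
    + (\<Sum>r<k. emeasure (measure_pmf (run G L A t r)) (distinguishing G L G' L' A t))"
proof -
  have "indicator S h \<le> (1 :: ennreal)" for h by (simp add: indicator_def)
  from nn_integral_run_le[OF assms, of "indicator S", OF this] show ?thesis by simp
qed

text \<open>A halted history is a fixed point of \<open>run_step\<close>, so a set of halted
  histories never loses mass.\<close>

lemma measure_run_mono:
  assumes "S \<inter> running G A t = {}" "k \<le> k'"
  shows "measure_pmf.prob (run G L A t k) S \<le> measure_pmf.prob (run G L A t k') S"
  using assms(2)
proof (induction rule: dec_induct)
  case (step n)
  have "indicator S h \<le> emeasure (measure_pmf (run_step G L A t h)) S" for h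
    using assms(1) by (auto simp: run_step_def running_def indicator_def split: action.split)
  then have "(\<integral>\<^sup>+h. indicator S h \<partial>measure_pmf (run G L A t n))
      \<le> (\<integral>\<^sup>+h. emeasure (measure_pmf (run_step G L A t h)) S \<partial>measure_pmf (run G L A t n))"
    by (intro nn_integral_mono) auto
  also have "\<dots> = emeasure (measure_pmf (run G L A t (Suc n))) S"
    by (simp add: run_Suc emeasure_bind_pmf)
  finally have "measure_pmf.prob (run G L A t n) S \<le> measure_pmf.prob (run G L A t (Suc n)) S"
    by (simp add: measure_pmf.emeasure_eq_measure)
  with step show ?case by linarith
qed simp

section \<open>From accuracy on many inputs to a time bound\<close>

definition accurate :: "real \<Rightarrow> real \<Rightarrow> nat pair_pre_digraph \<Rightarrow> algorithm \<Rightarrow> nat \<Rightarrow> reply list set" where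
  "accurate \<alpha> \<epsilon> G A t = {h. \<exists>x. A (card (pverts G)) t h = Output x \<and>
                \<bar>x - pagerank \<alpha> G t\<bar> < \<epsilon> * pagerank \<alpha> G t}"

text \<open>By monotonicity the supremum is approached at all late times, not just at one. This
  allows two runs to be inspected at a common time.\<close>

lemma success_prob_approx:
  assumes "p < success_prob \<alpha> \<epsilon> G L A t"
  obtains k where "\<And>k'. k \<le> k' \<Longrightarrow> p < measure_pmf.prob (run G L A t k') (accurate \<alpha> \<epsilon> G A t)"
proof -
  have "bdd_above (range (\<lambda>k. measure_pmf.prob (run G L A t k) (accurate \<alpha> \<epsilon> G A t)))"
    by (auto intro!: bdd_aboveI[of _ 1])
  then obtain k where "p < measure_pmf.prob (run G L A t k) (accurate \<alpha> \<epsilon> G A t)"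
    using assms unfolding success_prob_def accurate_def[symmetric] by (subst (asm) less_cSUP_iff) auto
  moreover have "accurate \<alpha> \<epsilon> G A t \<inter> running G A t = {}"
    by (auto simp: accurate_def running_def)
  ultimately show ?thesis
    using that measure_run_mono less_le_trans by blast
qed

text \<open>Le Cam's two-point argument: an output accurate for \<open>G\<close> occurs with
  probability at least \<open>1 - p\<close> on \<open>G\<close>, but at most \<open>p\<close> on
  \<open>G'\<close>, where it is an error. The gap is paid for by the steps that tell the inputs
  apart. The slack \<open>e\<close> is there because the suprema need not be attained.\<close>

lemma distinguishing_lower_bound:
  assumes same: "card (pverts G') = card (pverts G)"
    and succ: "1 - p \<le> success_prob \<alpha> \<epsilon> G L A t" "1 - p \<le> success_prob \<alpha> \<epsilon> G' L' A t"
    and sep: "(1 + \<epsilon>) * pagerank \<alpha> G t \<le> (1 - \<epsilon>) * pagerank \<alpha> G' t"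
  shows "ennreal (1 - 2 * p) \<le> (\<Sum>r. emeasure (measure_pmf (run G L A t r)) (distinguishing G L G' L' A t))"
proof (rule ennreal_le_epsilon)
  fix e :: real assume e: "e > 0"
  let ?B = "distinguishing G L G' L' A t"
  obtain k where k: "\<And>k'. k \<le> k' \<Longrightarrow> 1 - p - e/2 < measure_pmf.prob (run G L A t k') (accurate \<alpha> \<epsilon> G A t)"
    by (rule success_prob_approx[of "1 - p - e/2" \<alpha> \<epsilon> G L A t]) (use succ e in auto)
  obtain k' where k': "\<And>n. k' \<le> n \<Longrightarrow> 1 - p - e/2 < measure_pmf.prob (run G' L' A t n) (accurate \<alpha> \<epsilon> G' A t)"
    by (rule success_prob_approx[of "1 - p - e/2" \<alpha> \<epsilon> G' L' A t]) (use succ e in auto)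
  define s where "s = max k k'"
  \<comment> \<open>An output in both sets would lie strictly below
    \<open>(1 + \<epsilon>) * pagerank \<alpha> G t\<close> and strictly above
    \<open>(1 - \<epsilon>) * pagerank \<alpha> G' t\<close>, against \<open>sep\<close>.\<close>
  have disj: "accurate \<alpha> \<epsilon> G A t \<inter> accurate \<alpha> \<epsilon> G' A t = {}"
    using sep by (auto simp: accurate_def same abs_less_iff algebra_simps)
  have "measure_pmf.prob (run G' L' A t s) (accurate \<alpha> \<epsilon> G A t) +
        measure_pmf.prob (run G' L' A t s) (accurate \<alpha> \<epsilon> G' A t) \<le> 1"
    using disj by (subst measure_pmf.finite_measure_Union[symmetric]) auto
  then have small: "measure_pmf.prob (run G' L' A t s) (accurate \<alpha> \<epsilon> G A t) \<le> p + e/2"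
    using k'[of s] by (simp add: s_def)
  let ?d = "\<Sum>r<s. measure_pmf.prob (run G L A t r) ?B"
  have "ennreal (measure_pmf.prob (run G L A t s) (accurate \<alpha> \<epsilon> G A t))
     \<le> ennreal (measure_pmf.prob (run G' L' A t s) (accurate \<alpha> \<epsilon> G A t) + ?d)"
    using emeasure_run_le[OF same, of L A t s "accurate \<alpha> \<epsilon> G A t" L']
    by (simp add: measure_pmf.emeasure_eq_measure sum_nonneg)
  then have "measure_pmf.prob (run G L A t s) (accurate \<alpha> \<epsilon> G A t)
     \<le> measure_pmf.prob (run G' L' A t s) (accurate \<alpha> \<epsilon> G A t) + ?d"
    by (subst (asm) ennreal_le_iff) (auto intro!: add_nonneg_nonneg sum_nonneg)
  then have "1 - 2 * p \<le> ?d + e"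
    using small k[of s] by (simp add: s_def)
  then have "ennreal (1 - 2 * p) \<le> ennreal ?d + ennreal e"
    using e by (metis ennreal_leI ennreal_plus less_eq_real_def measure_nonneg sum_nonneg)
  also have "ennreal ?d = (\<Sum>r<s. emeasure (measure_pmf (run G L A t r)) ?B)"
    by (simp add: measure_pmf.emeasure_eq_measure)
  also have "\<dots> \<le> (\<Sum>r. emeasure (measure_pmf (run G L A t r)) ?B)"
    by (intro sum_le_suminf) auto
  finally show "ennreal (1 - 2 * p) \<le> (\<Sum>r. emeasure (measure_pmf (run G L A t r)) ?B) + ennreal e"
    by (simp add: add_right_mono)
qed

text \<open>Double counting over alternatives and steps: every alternative must be distinguished
  with total weight \<open>1 - 2 * p\<close>, while a history serves at most \<open>b\<close>
  alternatives at once, and none after halting. Exchanging the sums leaves \<open>b\<close> times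
  the sum of survival probabilities.\<close>

lemma expected_time_lower_bound:
  fixes G' :: "'i \<Rightarrow> nat pair_pre_digraph" and L' :: "'i \<Rightarrow> adj_lists"
  assumes I: "finite I"
    and same: "\<And>i. i \<in> I \<Longrightarrow> card (pverts (G' i)) = card (pverts G)"
    and succ: "1 - p \<le> success_prob \<alpha> \<epsilon> G L A t"
      "\<And>i. i \<in> I \<Longrightarrow> 1 - p \<le> success_prob \<alpha> \<epsilon> (G' i) (L' i) A t"
    and sep: "\<And>i. i \<in> I \<Longrightarrow> (1 + \<epsilon>) * pagerank \<alpha> G t \<le> (1 - \<epsilon>) * pagerank \<alpha> (G' i) t"
    and hits: "\<And>h q. A (card (pverts G)) t h = Query q \<Longrightarrow>
      card {i \<in> I. answer (G' i) (L' i) q \<noteq> answer G L q} \<le> b"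
  shows "of_nat (card I) * ennreal (1 - 2 * p) \<le> of_nat b * expected_time G L A t"
proof -
  let ?B = "\<lambda>i. distinguishing G L (G' i) (L' i) A t"
  let ?R = "running G A t"
  have count: "(\<Sum>i\<in>I. indicator (?B i) h) \<le> of_nat b * (indicator ?R h :: ennreal)" for h
  proof (cases "\<exists>q. A (card (pverts G)) t h = Query q")
    case True
    then obtain q where q: "A (card (pverts G)) t h = Query q" by blast
    have "(\<Sum>i\<in>I. indicator (?B i) h) = (\<Sum>i\<in>I. of_bool (answer (G' i) (L' i) q \<noteq> answer G L q) :: ennreal)"
      by (intro sum.cong) (auto simp: distinguishing_def q indicator_def)
    also have "\<dots> = of_nat (card {i \<in> I. answer (G' i) (L' i) q \<noteq> answer G L q})"
      using I by (simp add: of_bool_def sum.If_cases Int_def)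
    finally show ?thesis
      using hits[OF q] q by (simp add: running_def indicator_def)
  next
    case False
    then show ?thesis by (simp add: distinguishing_def)
  qed
  have "of_nat (card I) * ennreal (1 - 2 * p)
      \<le> (\<Sum>i\<in>I. \<Sum>r. emeasure (measure_pmf (run G L A t r)) (?B i))"
    using sum_mono[of I "\<lambda>_. ennreal (1 - 2 * p)"] same succ sep
    by (simp add: distinguishing_lower_bound[where \<alpha>=\<alpha> and \<epsilon>=\<epsilon>])
  also have "\<dots> = (\<Sum>r. \<Sum>i\<in>I. emeasure (measure_pmf (run G L A t r)) (?B i))"
    by (rule suminf_sum[symmetric]) auto
  also have "\<dots> \<le> (\<Sum>r. of_nat b * emeasure (measure_pmf (run G L A t r)) ?R)"
  proof (intro suminf_le)
    fix r
    have "(\<Sum>i\<in>I. emeasure (measure_pmf (run G L A t r)) (?B i))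
       = (\<integral>\<^sup>+h. (\<Sum>i\<in>I. indicator (?B i) h) \<partial>measure_pmf (run G L A t r))"
      by (subst nn_integral_sum) auto
    also have "\<dots> \<le> (\<integral>\<^sup>+h. of_nat b * indicator ?R h \<partial>measure_pmf (run G L A t r))"
      by (intro nn_integral_mono count)
    also have "\<dots> = of_nat b * emeasure (measure_pmf (run G L A t r)) ?R"
      by (subst nn_integral_cmult) auto
    finally show "(\<Sum>i\<in>I. emeasure (measure_pmf (run G L A t r)) (?B i)) \<le> \<dots>" .
  qed auto
  also have "\<dots> = of_nat b * expected_time G L A t"
    by (simp add: expected_time_eq_suminf)
  finally show ?thesis .
qed


section \<open>Bounds on termination probabilities\<close>

lemma pmf_bind_ge: "pmf p x * pmf (f x) y \<le> pmf (bind_pmf p f) y"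
proof -
  have "ennreal (pmf p x * pmf (f x) y) = (\<integral>\<^sup>+z. ennreal (pmf (f x) y) * indicator {x} z \<partial>measure_pmf p)"
    by (subst nn_integral_cmult_indicator)
      (auto simp: emeasure_pmf_single ennreal_mult mult.commute)
  also have "\<dots> \<le> (\<integral>\<^sup>+z. ennreal (pmf (f z) y) \<partial>measure_pmf p)"
    by (intro nn_integral_mono) (auto simp: indicator_def)
  also have "\<dots> = ennreal (pmf (bind_pmf p f) y)"
    by (simp add: ennreal_pmf_bind)
  finally show ?thesis by simp
qed

lemma pmf_walk_arc:
  assumes "0 \<le> \<alpha>" "\<alpha> \<le> 1" "finite (parcs G `` {u})" "(u, v) \<in> parcs G"
  shows "pmf (walk \<alpha> G s k) (Walking u) * ((1 - \<alpha>) / card (parcs G `` {u}))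
    \<le> pmf (walk \<alpha> G s (Suc k)) (Walking v)"
proof -
  have "parcs G `` {u} \<noteq> {}" "v \<in> parcs G `` {u}" using assms by auto
  then have "pmf (walk_step \<alpha> G (Walking u)) (Walking v) = (1 - \<alpha>) / card (parcs G `` {u})"
    using assms by (simp add: pmf_bind pmf_map_inj' inj_def)
  then show ?thesis
    using pmf_bind_ge[of "walk \<alpha> G s k" "Walking u" "walk_step \<alpha> G" "Walking v"] by simp
qed

lemma ppr_ge_walk:
  assumes "0 \<le> \<alpha>" "\<alpha> \<le> 1"
  shows "pmf (walk \<alpha> G s k) (Walking t) * \<alpha> \<le> ppr \<alpha> G s t"
proof -
  have "\<alpha> \<le> pmf (walk_step \<alpha> G (Walking t)) (Stopped t)"
    using assms by (simp add: pmf_bind)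
  then have "pmf (walk \<alpha> G s k) (Walking t) * \<alpha>
     \<le> pmf (walk \<alpha> G s k) (Walking t) * pmf (walk_step \<alpha> G (Walking t)) (Stopped t)"
    by (intro mult_left_mono) auto
  also have "\<dots> \<le> pmf (walk \<alpha> G s (Suc k)) (Stopped t)"
    using pmf_bind_ge[of "walk \<alpha> G s k" "Walking t" "walk_step \<alpha> G" "Stopped t"] by simp
  also have "\<dots> \<le> ppr \<alpha> G s t"
    unfolding ppr_def by (rule cSUP_upper) (auto intro!: bdd_aboveI[of _ 1] simp: pmf_le_1)
  finally show ?thesis .
qed

lemma ppr_nonneg: "0 \<le> ppr \<alpha> G s t"
  unfolding ppr_def
  by (rule cSUP_upper2[of _ _ 0]) (auto intro!: bdd_aboveI[of _ 1] simp: pmf_le_1)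

text \<open>Length three is what is needed later for the route from a source through a middle node
  and a hub to a target, which exists only after a swap.\<close>

lemma ppr_path3:
  assumes \<alpha>: "0 \<le> \<alpha>" "\<alpha> \<le> 1" and fin: "finite (parcs G)"
    and path: "(s, x) \<in> parcs G" "(x, y) \<in> parcs G" "(y, t) \<in> parcs G"
  shows "(1 - \<alpha>) ^ 3 * \<alpha> / (real (card (parcs G `` {s})) * real (card (parcs G `` {x})) * real (card (parcs G `` {y})))
     \<le> ppr \<alpha> G s t"
proof -
  have fin': "finite (parcs G `` {u})" for u
    using fin by (rule finite_Image)
  define q where "q u = (1 - \<alpha>) / card (parcs G `` {u})" for u
  have q: "0 \<le> q u" for u using \<alpha> by (simp add: q_def)
  have "q s \<le> pmf (walk \<alpha> G s 1) (Walking x)"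
    using pmf_walk_arc[OF \<alpha> fin' path(1), of s 0] by (simp add: q_def)
  then have "q s * q x \<le> pmf (walk \<alpha> G s 1) (Walking x) * q x"
    by (intro mult_right_mono q)
  also have "\<dots> \<le> pmf (walk \<alpha> G s 2) (Walking y)"
    using pmf_walk_arc[OF \<alpha> fin' path(2), of s 1] by (simp add: q_def numeral_2_eq_2 del: walk.simps)
  finally have "q s * q x * q y \<le> pmf (walk \<alpha> G s 2) (Walking y) * q y"
    by (intro mult_right_mono q)
  also have "\<dots> \<le> pmf (walk \<alpha> G s 3) (Walking t)"
    using pmf_walk_arc[OF \<alpha> fin' path(3), of s 2] by (simp add: q_def numeral_3_eq_3 numeral_2_eq_2 del: walk.simps)
  finally have "q s * q x * q y * \<alpha> \<le> pmf (walk \<alpha> G s 3) (Walking t) * \<alpha>"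
    using \<alpha> by (intro mult_right_mono)
  also have "\<dots> \<le> ppr \<alpha> G s t" by (rule ppr_ge_walk[OF \<alpha>])
  finally show ?thesis by (simp add: q_def power3_eq_cube)
qed

text \<open>Extended to stopped states by the indicator of \<open>t\<close>, the function
  \<open>f\<close> becomes a supermartingale along the walk. Its expectation never exceeds the
  initial value \<open>f s\<close>, and it dominates the indicator of having stopped at
  \<open>t\<close>.\<close>

lemma ppr_le_superharmonic:
  fixes f :: "nat \<Rightarrow> real"
  assumes \<alpha>: "0 \<le> \<alpha>" "\<alpha> \<le> 1" and G: "input_graph G" and s: "s \<in> pverts G"
    and nonneg: "\<And>u. 0 \<le> f u"
    and super: "\<And>u. u \<in> pverts G \<Longrightarrow>
      (if u = t then \<alpha> else 0) + (1 - \<alpha>) * ((\<Sum>v\<in>parcs G `` {u}. f v) / card (parcs G `` {u})) \<le> f u"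
  shows "ppr \<alpha> G s t \<le> f s"
proof -
  interpret pair_fin_digraph G using G by (simp add: input_graph_def)
  have out: "finite (parcs G `` {u})" "u \<in> pverts G \<Longrightarrow> parcs G `` {u} \<noteq> {}" for u
    using G pair_finite_arcs by (auto simp: input_graph_def finite_Image)
  define \<Phi> where "\<Phi> z = (case z of Walking u \<Rightarrow> ennreal (f u) | Stopped u \<Rightarrow> of_bool (u = t))" for z
  have step: "(\<integral>\<^sup>+z'. \<Phi> z' \<partial>measure_pmf (walk_step \<alpha> G z)) \<le> \<Phi> z" if "z \<in> Walking ` pverts G \<union> range Stopped" for z
  proof (cases z)
    case (Walking u)
    with that have u: "u \<in> pverts G" by auto
    let ?O = "parcs G `` {u}"
    have "(\<integral>\<^sup>+z'. \<Phi> z' \<partial>measure_pmf (walk_step \<alpha> G z))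
      = ennreal \<alpha> * of_bool (u = t) + ennreal (1 - \<alpha>) * ((\<Sum>v\<in>?O. ennreal (f v)) / of_nat (card ?O))"
      using \<alpha> out u
      by (simp add: Walking nn_integral_bind_pmf nn_integral_bernoulli_pmf nn_integral_return
          nn_integral_pmf_of_set \<Phi>_def mult.commute ennreal_of_nat_eq_real_of_nat)
    also have "\<dots> = ennreal ((if u = t then \<alpha> else 0) + (1 - \<alpha>) * ((\<Sum>v\<in>?O. f v) / card ?O))"
      using \<alpha> nonneg out u by (auto simp: sum_nonneg divide_ennreal ennreal_mult[symmetric] ennreal_of_nat_eq_real_of_nat card_gt_0_iff)
    also have "\<dots> \<le> ennreal (f u)"
      using super[OF u] by (rule ennreal_leI)
    finally show ?thesis by (simp add: \<Phi>_def Walking)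
  qed (simp add: nn_integral_return)
  \<comment> \<open>The inequality \<open>super\<close> is given only at nodes, so the walk has to
    be confined to them.\<close>
  have supp: "set_pmf (walk \<alpha> G s k) \<subseteq> Walking ` pverts G \<union> range Stopped" for k
  proof (induction k)
    case (Suc k)
    have "set_pmf (walk_step \<alpha> G z) \<subseteq> Walking ` pverts G \<union> range Stopped"
      if "z \<in> Walking ` pverts G \<union> range Stopped" for z
    proof (cases z)
      case (Walking u)
      with that have u: "u \<in> pverts G" by auto
      have "parcs G `` {u} \<subseteq> pverts G"
        using arc_snd_in_verts by force
      moreover have "set_pmf (walk_step \<alpha> G z) \<subseteq> insert (Stopped u) (Walking ` (parcs G `` {u}))"
        using Walking out u by (auto split: if_splits)
      ultimately show ?thesis by blast
    qed simp
    with Suc show ?case unfolding walk.simps set_bind_pmf by blast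
  qed (use s in simp)
  have bound: "(\<integral>\<^sup>+z. \<Phi> z \<partial>measure_pmf (walk \<alpha> G s k)) \<le> ennreal (f s)" for k
  proof (induction k)
    case (Suc k)
    have "(\<integral>\<^sup>+z. \<Phi> z \<partial>measure_pmf (walk \<alpha> G s (Suc k)))
       = (\<integral>\<^sup>+z. (\<integral>\<^sup>+z'. \<Phi> z' \<partial>measure_pmf (walk_step \<alpha> G z)) \<partial>measure_pmf (walk \<alpha> G s k))"
      by (simp add: nn_integral_bind_pmf)
    also have "\<dots> \<le> (\<integral>\<^sup>+z. \<Phi> z \<partial>measure_pmf (walk \<alpha> G s k))"
      using supp[of k] step by (intro nn_integral_mono_AE) (auto simp: AE_measure_pmf_iff)
    finally show ?case using Suc by simp
  qed (simp add: \<Phi>_def)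
  have "pmf (walk \<alpha> G s k) (Stopped t) \<le> f s" for k
  proof -
    have "ennreal (pmf (walk \<alpha> G s k) (Stopped t)) = (\<integral>\<^sup>+z. indicator {Stopped t} z \<partial>measure_pmf (walk \<alpha> G s k))"
      by (simp add: emeasure_pmf_single)
    also have "\<dots> \<le> (\<integral>\<^sup>+z. \<Phi> z \<partial>measure_pmf (walk \<alpha> G s k))"
      by (intro nn_integral_mono) (auto simp: \<Phi>_def indicator_def)
    also note bound
    finally show ?thesis using nonneg by simp
  qed
  then show ?thesis
    unfolding ppr_def by (intro cSUP_least) auto
qed


section \<open>Swapping the heads of two arcs\<close>

definition swap_arcs :: "('a \<times> 'b) set \<Rightarrow> 'a \<Rightarrow> 'b \<Rightarrow> 'a \<Rightarrow> 'b \<Rightarrow> ('a \<times> 'b) set" where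
  "swap_arcs E a b c d = E - {(a, b), (c, d)} \<union> {(a, d), (c, b)}"

text \<open>The swap as seen from \<open>x\<close>: its effect on a single out-neighbour
  \<open>y\<close>. In this form it can be mapped over an adjacency list without moving entries.
  Exchanging the roles of heads and tails gives the effect on in-neighbours.\<close>

definition redirect :: "'a \<Rightarrow> 'b \<Rightarrow> 'a \<Rightarrow> 'b \<Rightarrow> 'a \<Rightarrow> 'b \<Rightarrow> 'b" where
  "redirect a b c d x y = (if (x, y) = (a, b) then d else if (x, y) = (c, d) then b else y)"

lemma converse_swap_arcs: "(swap_arcs E a b c d)\<inverse> = swap_arcs (E\<inverse>) b a d c"
  by (auto simp: swap_arcs_def)

lemma swap_arcs_Image:
  assumes "(a, b) \<in> E" "(c, d) \<in> E" "(a, d) \<notin> E" "(c, b) \<notin> E"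
  shows "swap_arcs E a b c d `` {x} = redirect a b c d x ` (E `` {x})"
proof -
  have "y \<in> redirect a b c d x ` (E `` {x})" if "(x, y) \<in> swap_arcs E a b c d" for y
  proof (cases "(x, y) = (a, d) \<or> (x, y) = (c, b)")
    case True
    then show ?thesis
    proof
      assume "(x, y) = (a, d)"
      then show ?thesis using assms by (intro image_eqI[of _ _ b]) (auto simp: redirect_def)
    next
      assume "(x, y) = (c, b)"
      then show ?thesis using assms by (intro image_eqI[of _ _ d]) (auto simp: redirect_def)
    qed
  next
    case False
    then show ?thesis using that by (intro image_eqI[of _ _ y]) (auto simp: redirect_def swap_arcs_def)
  qed
  moreover have "(x, redirect a b c d x y) \<in> swap_arcs E a b c d" if "(x, y) \<in> E" for y
    using that assms by (auto simp: redirect_def swap_arcs_def)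
  ultimately show ?thesis by auto
qed

text \<open>A new head cannot collide with an old neighbour, since \<open>(a, d)\<close> and
  \<open>(c, b)\<close> are not arcs; this also forces \<open>a\<close> to differ from
  \<open>c\<close> and \<open>b\<close> from \<open>d\<close>.\<close>

lemma inj_on_redirect:
  assumes "(a, b) \<in> E" "(c, d) \<in> E" "(a, d) \<notin> E" "(c, b) \<notin> E"
  shows "inj_on (redirect a b c d x) (E `` {x})"
  using assms by (auto simp: inj_on_def redirect_def split: if_splits)

lemma out_degree_with_proj: "out_degree (with_proj G) u = card (parcs G `` {u})"
proof -
  have "out_arcs (with_proj G) u = Pair u ` (parcs G `` {u})"
    by (auto simp: out_arcs_def)
  then show ?thesis by (simp add: out_degree_def card_image inj_on_def)
qed

lemma in_degree_with_proj: "in_degree (with_proj G) u = card ((parcs G)\<inverse> `` {u})"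
proof -
  have "in_arcs (with_proj G) u = (\<lambda>x. (x, u)) ` ((parcs G)\<inverse> `` {u})"
    by (auto simp: in_arcs_def)
  then show ?thesis by (simp add: in_degree_def card_image inj_on_def)
qed

text \<open>With \<open>ADJ\<close> the sorted lists cannot be observed, so they may be re-sorted from scratch. With
  \<open>IN-SORTED\<close> the swap is only used between sources of equal out-degree, where redirecting in place
  keeps the list sorted.\<close>

definition swap_lists ::
    "extra_query \<Rightarrow> nat pair_pre_digraph \<Rightarrow> adj_lists \<Rightarrow> nat \<Rightarrow> nat \<Rightarrow> nat \<Rightarrow> nat \<Rightarrow> adj_lists" where
  "swap_lists X G L a b c d =
    \<lparr>in_list = (\<lambda>y. map (redirect b a d c y) (in_list L y)),
     out_list = (\<lambda>x. map (redirect a b c d x) (out_list L x)),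
     in_sorted_list = (\<lambda>y. if X = With_In_Sorted then map (redirect b a d c y) (in_sorted_list L y)
        else sort_key (out_degree (with_proj G)) (map (redirect b a d c y) (in_list L y)))\<rparr>"

text \<open>Junk for degree and \<open>JUMP\<close> queries and for indices out of range; the answers to these are
  unaffected by a swap.\<close>

fun probed_arc :: "adj_lists \<Rightarrow> query \<Rightarrow> nat \<times> nat" where
  "probed_arc L (In y p) = (in_list L y ! (p - 1), y)"
| "probed_arc L (In_Sorted y p) = (in_sorted_list L y ! (p - 1), y)"
| "probed_arc L (Out x p) = (x, out_list L x ! (p - 1))"
| "probed_arc L (Adj x y) = (x, y)"
| "probed_arc L _ = (0, 0)"

section \<open>Effect of a swap on degrees, lists and answers\<close>

locale arc_swap =
  fixes G :: "nat pair_pre_digraph" and a b c d :: nat and G' :: "nat pair_pre_digraph"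
  assumes G: "input_graph G"
    and arcs: "(a, b) \<in> parcs G" "(c, d) \<in> parcs G" "(a, d) \<notin> parcs G" "(c, b) \<notin> parcs G"
    and G': "G' = \<lparr>pverts = pverts G, parcs = swap_arcs (parcs G) a b c d\<rparr>"
begin

lemma out_swap: "parcs G' `` {x} = redirect a b c d x ` (parcs G `` {x})"
  by (simp add: G' swap_arcs_Image[OF arcs])

lemma in_swap: "(parcs G')\<inverse> `` {y} = redirect b a d c y ` ((parcs G)\<inverse> `` {y})"
  using arcs by (simp add: G' converse_swap_arcs swap_arcs_Image)

lemma inj_out: "inj_on (redirect a b c d x) (parcs G `` {x})"
  by (rule inj_on_redirect[OF arcs])

lemma inj_in: "inj_on (redirect b a d c y) ((parcs G)\<inverse> `` {y})"
  using arcs by (intro inj_on_redirect) auto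

lemma card_out_swap: "card (parcs G' `` {x}) = card (parcs G `` {x})"
  by (simp add: out_swap card_image[OF inj_out])

lemma out_degree_swap: "out_degree (with_proj G') x = out_degree (with_proj G) x"
  by (simp add: out_degree_with_proj card_out_swap)

lemma in_degree_swap: "in_degree (with_proj G') x = in_degree (with_proj G) x"
  by (simp add: in_degree_with_proj in_swap card_image[OF inj_in])

lemma input_graph_swap: "input_graph G'"
proof -
  interpret pair_fin_digraph G using G by (simp add: input_graph_def)
  have "pair_fin_digraph G'"
    using arcs pair_finite_arcs pair_finite_verts
    by unfold_locales (auto simp: G' swap_arcs_def dest: in_arcsD1 in_arcsD2)
  moreover have "parcs G' `` {u} \<noteq> {}" if "u \<in> pverts G'" for u
    using that G by (simp only: out_swap) (simp add: input_graph_def G')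
  ultimately show ?thesis using G by (simp add: input_graph_def G')
qed

lemma adj_lists_of_swap:
  assumes L: "adj_lists_of G L"
    and deg: "X = With_In_Sorted \<Longrightarrow> card (parcs G `` {a}) = card (parcs G `` {c})"
  shows "adj_lists_of G' (swap_lists X G L a b c d)"
proof -
  have "sorted (map (out_degree (with_proj G')) (map (redirect b a d c u) (in_sorted_list L u)))"
    if "u \<in> pverts G" "X = With_In_Sorted" for u
  proof -
    \<comment> \<open>In an in-list the redirection can only replace \<open>a\<close> by
      \<open>c\<close> or \<open>c\<close> by \<open>a\<close>. These have equal out-degree, so the
      sequence of sorting keys is unchanged.\<close>
    have "out_degree (with_proj G') (redirect b a d c u v) = out_degree (with_proj G) v" for v
    proof -
      consider "(u, v) = (b, a)" | "(u, v) \<noteq> (b, a)" "(u, v) = (d, c)"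
        | "(u, v) \<noteq> (b, a)" "(u, v) \<noteq> (d, c)" by blast
      then show ?thesis
      proof cases
        case 1
        then have "redirect b a d c u v = c" "v = a" by (simp_all add: redirect_def)
        then show ?thesis using deg[OF that(2)] by (metis out_degree_swap out_degree_with_proj)
      next
        case 2
        then have "redirect b a d c u v = a" "v = c" by (auto simp: redirect_def)
        then show ?thesis using deg[OF that(2)] by (metis out_degree_swap out_degree_with_proj)
      next
        case 3
        then have "redirect b a d c u v = v" unfolding redirect_def by (simp only: if_False)
        then show ?thesis unfolding out_degree_swap by (rule arg_cong)
      qed
    qed
    then have eq: "map (out_degree (with_proj G')) (map (redirect b a d c u) (in_sorted_list L u))
      = map (out_degree (with_proj G)) (in_sorted_list L u)"
      by simp
    have "sorted (map (out_degree (with_proj G)) (in_sorted_list L u))"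
      using L that(1) by (simp add: adj_lists_of_def)
    then show ?thesis unfolding eq .
  qed
  note sorted_map = this
  have sorted: "sorted (map (out_degree (with_proj G')) (in_sorted_list (swap_lists X G L a b c d) u))"
    if "u \<in> pverts G" for u
  proof -
    have "out_degree (with_proj G') = out_degree (with_proj G)"
      by (rule ext) (rule out_degree_swap)
    then have "sorted (map (out_degree (with_proj G')) (sort_key (out_degree (with_proj G)) xs))" for xs
      by simp
    with that sorted_map[OF that] show ?thesis
      by (simp add: swap_lists_def del: map_map)
  qed
  show ?thesis
    unfolding adj_lists_of_def
  proof (intro ballI)
    fix u assume "u \<in> pverts G'"
    then have u: "u \<in> pverts G" by (simp add: G')
    note lists = L[unfolded adj_lists_of_def, rule_format, OF u]
    have "distinct (map (redirect b a d c u) xs)" "set (map (redirect b a d c u) xs) = (parcs G')\<inverse> `` {u}"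
      if "distinct xs" "set xs = (parcs G)\<inverse> `` {u}" for xs
      unfolding in_swap distinct_map set_map that(2) using inj_in[of u] that(1) by (rule conjI[rotated]) (rule refl)
    moreover have "distinct (map (redirect a b c d u) xs)" "set (map (redirect a b c d u) xs) = parcs G' `` {u}"
      if "distinct xs" "set xs = parcs G `` {u}" for xs
      unfolding out_swap distinct_map set_map that(2) using inj_out[of u] that(1) by (rule conjI[rotated]) (rule refl)
    ultimately show "distinct (in_list (swap_lists X G L a b c d) u) \<and>
        set (in_list (swap_lists X G L a b c d) u) = (parcs G')\<inverse> `` {u} \<and>
        distinct (out_list (swap_lists X G L a b c d) u) \<and>
        set (out_list (swap_lists X G L a b c d) u) = parcs G' `` {u} \<and>
        distinct (in_sorted_list (swap_lists X G L a b c d) u) \<and>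
        set (in_sorted_list (swap_lists X G L a b c d) u) = (parcs G')\<inverse> `` {u} \<and>
        sorted (map (out_degree (with_proj G')) (in_sorted_list (swap_lists X G L a b c d) u))"
      using lists sorted[OF u] by (simp add: swap_lists_def del: set_map Image_singleton_iff)
  qed
qed

lemma nth_reply_redirect:
  assumes "nth_reply (map (redirect w x y z u) xs) i \<noteq> nth_reply xs i"
  shows "(u, xs ! (i - 1)) = (w, x) \<or> (u, xs ! (i - 1)) = (y, z)"
  using assms by (auto simp: nth_reply_def redirect_def split: if_splits)

text \<open>A list query reads one arc, and its reply changes only if that arc is one of the two
  removed. Only an adjacency query can also notice the two arcs that are added.\<close>

lemma answer_swap_cases:
  assumes X: "allowed X q" and neq: "answer G' (swap_lists X G L a b c d) q \<noteq> answer G L q"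
  shows "probed_arc L q \<in> {(a, b), (c, d)} \<or> X = With_Adj \<and> probed_arc L q \<in> {(a, d), (c, b)}"
proof -
  have [simp]: "pverts G' = pverts G" by (simp add: G')
  show ?thesis
  proof (cases q)
    case (In y i)
    with neq have "nth_reply (map (redirect b a d c y) (in_list L y)) i \<noteq> nth_reply (in_list L y) i"
      by (auto simp: swap_lists_def split: if_splits)
    from nth_reply_redirect[OF this] In show ?thesis by auto
  next
    case (Out x i)
    with neq have "nth_reply (map (redirect a b c d x) (out_list L x)) i \<noteq> nth_reply (out_list L x) i"
      by (auto simp: swap_lists_def split: if_splits)
    from nth_reply_redirect[OF this] Out show ?thesis by auto
  next
    \<comment> \<open>Here \<open>allowed\<close> forces \<open>X = With_In_Sorted\<close>, so the
      sorted list was redirected in place rather than sorted afresh.\<close>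
    case (In_Sorted y i)
    with neq X have "nth_reply (map (redirect b a d c y) (in_sorted_list L y)) i \<noteq> nth_reply (in_sorted_list L y) i"
      by (auto simp: swap_lists_def split: if_splits)
    from nth_reply_redirect[OF this] In_Sorted show ?thesis by auto
  next
    case (Adj x y)
    have "(x, y) \<in> parcs G' \<longleftrightarrow> (x, y) \<in> parcs G" if "(x, y) \<notin> {(a, b), (c, d), (a, d), (c, b)}"
      using that by (auto simp: G' swap_arcs_def)
    then show ?thesis using Adj X neq by (auto split: if_splits)
  qed (use neq in \<open>auto simp: out_degree_swap in_degree_swap split: if_splits\<close>)
qed

end


section \<open>The hard graph\<close>

text \<open>The tag \<open>c\<close> keeps the classes of nodes disjoint inside the natural numbers;
  \<open>i\<close> is the index in the class and \<open>r\<close> numbers the copies belonging to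
  that index.\<close>

definition node :: "nat \<Rightarrow> nat \<Rightarrow> nat \<Rightarrow> nat" where
  "node c i r = prod_encode (c, prod_encode (i, r))"

lemma node_eq_iff [simp]: "node c i r = node c' i' r' \<longleftrightarrow> c = c' \<and> i = i' \<and> r = r'"
  by (simp add: node_def)

abbreviation "Src \<equiv> node 0"
abbreviation "Mid i \<equiv> node 6 i 0"
abbreviation "Sink j \<equiv> node 2 j 0"
abbreviation "Feeder l \<equiv> node 3 l 0"
abbreviation "Hub h \<equiv> node 4 h 0"
abbreviation "Tgt \<equiv> node 5"

lemma card_Un6_le:
  assumes "card A1 \<le> n1" "card A2 \<le> n2" "card A3 \<le> n3" "card A4 \<le> n4" "card A5 \<le> n5" "card A6 \<le> n6"
  shows "card (A1 \<union> A2 \<union> A3 \<union> A4 \<union> A5 \<union> A6) \<le> n1 + n2 + n3 + n4 + n5 + n6"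
  using assms card_Un_le[of A1 A2] card_Un_le[of "A1 \<union> A2" A3] card_Un_le[of "A1 \<union> A2 \<union> A3" A4]
    card_Un_le[of "A1 \<union> A2 \<union> A3 \<union> A4" A5] card_Un_le[of "A1 \<union> A2 \<union> A3 \<union> A4 \<union> A5" A6] by linarith

locale hard_instance =
  fixes k D K :: nat and X :: extra_query
  assumes k: "0 < k" and D: "0 < D"
begin

text \<open>With \<open>IN-SORTED\<close> all the weight sits in one middle node of out-degree \<open>k\<close>, the out-degree of a
  feeder, so that sorting in-neighbours does not expose the swapped arc. With \<open>ADJ\<close> there are \<open>k\<close>
  middle nodes of out-degree 1, so that a single adjacency query rules out only one of them.\<close>

definition mid :: "nat \<Rightarrow> nat" where
  "mid j = (if X = With_Adj then j else 0)"

definition hard_verts :: "nat set" where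
  "hard_verts = (\<lambda>(j, r). Src j r) ` ({..<k} \<times> {..<K * D}) \<union> (\<lambda>j. Mid (mid j)) ` {..<k}
     \<union> (\<lambda>j. Sink j) ` {..<k} \<union> (\<lambda>l. Feeder l) ` {..<k} \<union> (\<lambda>h. Hub h) ` {..<k}
     \<union> (\<lambda>(h, r). Tgt h r) ` ({..<k} \<times> {..<D})"

text \<open>The loops give sinks and targets the out-neighbour that an input graph requires, and
  trap the walk there.\<close>

definition hard_arcs :: "(nat \<times> nat) set" where
  "hard_arcs = (\<lambda>(j, r). (Src j r, Mid (mid j))) ` ({..<k} \<times> {..<K * D})
     \<union> (\<lambda>j. (Mid (mid j), Sink j)) ` {..<k} \<union> (\<lambda>j. (Sink j, Sink j)) ` {..<k}
     \<union> (\<lambda>(l, h). (Feeder l, Hub h)) ` ({..<k} \<times> {..<k})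
     \<union> (\<lambda>(h, r). (Hub h, Tgt h r)) ` ({..<k} \<times> {..<D})
     \<union> (\<lambda>(h, r). (Tgt h r, Tgt h r)) ` ({..<k} \<times> {..<D})"

definition hard_graph :: "nat pair_pre_digraph" where
  "hard_graph = \<lparr>pverts = hard_verts, parcs = hard_arcs\<rparr>"

lemma hard_graph_simps [simp]: "pverts hard_graph = hard_verts" "parcs hard_graph = hard_arcs"
  by (simp_all add: hard_graph_def)

lemma finite_hard_verts [simp]: "finite hard_verts"
  by (simp add: hard_verts_def)

lemma finite_hard_arcs [simp]: "finite hard_arcs"
  by (simp add: hard_arcs_def)

lemma hard_arcs_Image:
  "j < k \<Longrightarrow> r < K * D \<Longrightarrow> hard_arcs `` {Src j r} = {Mid (mid j)}"
  "hard_arcs `` {Mid i} = (\<lambda>j. Sink j) ` {j. j < k \<and> mid j = i}"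
  "j < k \<Longrightarrow> hard_arcs `` {Sink j} = {Sink j}"
  "l < k \<Longrightarrow> hard_arcs `` {Feeder l} = (\<lambda>h. Hub h) ` {..<k}"
  "h < k \<Longrightarrow> hard_arcs `` {Hub h} = Tgt h ` {..<D}"
  "h < k \<Longrightarrow> r' < D \<Longrightarrow> hard_arcs `` {Tgt h r'} = {Tgt h r'}"
  by (auto simp: hard_arcs_def)

lemma hard_verts_cases:
  assumes "u \<in> hard_verts"
  obtains (Src) j r where "u = Src j r" "j < k" "r < K * D"
  | (Mid) j where "u = Mid (mid j)" "j < k"
  | (Sink) j where "u = Sink j" "j < k"
  | (Feeder) l where "u = Feeder l" "l < k"
  | (Hub) h where "u = Hub h" "h < k"
  | (Tgt) h r where "u = Tgt h r" "h < k" "r < D"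
  using assms unfolding hard_verts_def by auto

lemma input_graph_hard_graph: "input_graph hard_graph"
proof -
  have "pair_fin_digraph hard_graph"
    by unfold_locales (auto simp: hard_arcs_def hard_verts_def)
  moreover have "Hub 0 \<in> hard_verts" using k by (auto simp: hard_verts_def)
  moreover have "hard_arcs `` {u} \<noteq> {}" if "u \<in> hard_verts" for u
    using that k D by (cases rule: hard_verts_cases) (auto simp: hard_arcs_Image)
  ultimately show ?thesis by (auto simp: input_graph_def)
qed

lemma card_hard_verts_ge: "k * D \<le> card hard_verts"
proof -
  have "k * D = card ((\<lambda>(h, r). Tgt h r) ` ({..<k} \<times> {..<D}))"
    by (subst card_image) (auto simp: inj_on_def)
  also have "\<dots> \<le> card hard_verts"
    by (intro card_mono) (auto simp: hard_verts_def)
  finally show ?thesis .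
qed

lemma card_hard_arcs_ge: "k * k \<le> card hard_arcs"
proof -
  have "k * k = card ((\<lambda>(l, h). (Feeder l, Hub h)) ` ({..<k} \<times> {..<k}))"
    by (subst card_image) (auto simp: inj_on_def)
  also have "\<dots> \<le> card hard_arcs"
    by (intro card_mono) (auto simp: hard_arcs_def)
  finally show ?thesis .
qed

lemma card_hard_verts_le: "card hard_verts \<le> k * (K * D) + 4 * k + k * D"
proof -
  have "card hard_verts \<le> k * (K * D) + k + k + k + k + k * D"
    unfolding hard_verts_def
    by (rule card_Un6_le) (auto intro!: order.trans[OF card_image_le])
  then show ?thesis by simp
qed

lemma card_hard_arcs_le: "card hard_arcs \<le> k * (K * D) + 2 * k + k * k + 2 * (k * D)"
proof -
  have "card hard_arcs \<le> k * (K * D) + k + k + k * k + k * D + k * D"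
    unfolding hard_arcs_def
    by (rule card_Un6_le) (auto intro!: order.trans[OF card_image_le])
  then show ?thesis by simp
qed

section \<open>PageRank of the targets before and after a swap\<close>

text \<open>A superharmonic majorant of the probability of terminating at \<open>Tgt h r\<close>.\<close>

definition potential :: "nat \<Rightarrow> nat \<Rightarrow> nat \<Rightarrow> real" where
  "potential h r u = of_bool (u = Tgt h r) + of_bool (u = Hub h) / D
     + of_bool (u \<in> (\<lambda>l. Feeder l) ` {..<k}) / (k * D)"

text \<open>The potential is the probability that an undiscounted walk hits the target: 1 over
  \<open>D\<close> from its hub and 1 over \<open>k * D\<close> from a feeder. It equals its own
  average over out-neighbours, and discounting only lowers that average. At the target the
  inequality reads \<open>\<alpha> + (1 - \<alpha>) \<le> 1\<close>.\<close>

lemma ppr_hard_graph_le: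
  fixes \<alpha> :: real
  assumes \<alpha>: "0 \<le> \<alpha>" "\<alpha> \<le> 1" and hr: "h < k" "r < D" and s: "s \<in> hard_verts"
  shows "ppr \<alpha> hard_graph s (Tgt h r) \<le> potential h r s"
proof (rule ppr_le_superharmonic[OF \<alpha> input_graph_hard_graph])
  show "s \<in> pverts hard_graph" using s by simp
  show "0 \<le> potential h r u" for u by (simp add: potential_def)
next
  fix u assume "u \<in> pverts hard_graph"
  then have "u \<in> hard_verts" by simp
  then show "(if u = Tgt h r then \<alpha> else 0) + (1 - \<alpha>) *
      ((\<Sum>v\<in>parcs hard_graph `` {u}. potential h r v) / card (parcs hard_graph `` {u})) \<le> potential h r u"
  proof (cases rule: hard_verts_cases)
    case (Src j r')
    then show ?thesis by (auto simp: hard_arcs_Image potential_def)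
  next
    case (Mid j)
    have "(\<Sum>v\<in>hard_arcs `` {u}. potential h r v) = 0"
      by (intro sum.neutral) (auto simp: Mid hard_arcs_Image potential_def)
    then show ?thesis using Mid by (simp add: potential_def)
  next
    case (Sink j)
    then show ?thesis by (auto simp: hard_arcs_Image potential_def)
  next
    case (Feeder l)
    have "(\<Sum>v\<in>hard_arcs `` {u}. potential h r v) = (\<Sum>h'<k. potential h r (Hub h'))"
      by (simp add: Feeder hard_arcs_Image sum.reindex inj_on_def)
    also have "\<dots> = (\<Sum>h'<k. if h' = h then 1 / D else 0)"
      by (intro sum.cong) (auto simp: potential_def)
    also have "\<dots> = 1 / D" using hr by simp
    finally have 1: "(\<Sum>v\<in>hard_arcs `` {u}. potential h r v) = 1 / D" .
    have 2: "card (hard_arcs `` {u}) = k"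
      by (simp add: Feeder hard_arcs_Image card_image inj_on_def)
    have "potential h r u = 1 / (k * D)" "u \<noteq> Tgt h r" using Feeder by (simp_all add: potential_def)
    then show ?thesis
      using \<alpha> k D by (simp add: 1 2 field_simps)
  next
    case (Hub h')
    have "(\<Sum>v\<in>hard_arcs `` {u}. potential h r v) = (\<Sum>r'<D. potential h r (Tgt h' r'))"
      by (simp add: Hub hard_arcs_Image sum.reindex inj_on_def)
    also have "\<dots> = (\<Sum>r'<D. if r' = r then of_bool (h' = h) else 0)"
      by (intro sum.cong) (auto simp: potential_def)
    also have "\<dots> = of_bool (h' = h)" using hr by simp
    finally have 1: "(\<Sum>v\<in>hard_arcs `` {u}. potential h r v) = of_bool (h' = h)" .
    have 2: "card (hard_arcs `` {u}) = D"
      by (simp add: Hub hard_arcs_Image card_image inj_on_def)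
    have "potential h r u = of_bool (h' = h) / D" "u \<noteq> Tgt h r" using Hub by (auto simp: potential_def)
    then show ?thesis
      using \<alpha> D by (simp add: 1 2 divide_right_mono)
  next
    case (Tgt h' r')
    then show ?thesis using \<alpha> by (auto simp: hard_arcs_Image potential_def)
  qed
qed

text \<open>The 3 collects at most 1 each from the target itself, its hub, and all \<open>k\<close>
  feeders together.\<close>

lemma pagerank_hard_graph_le:
  fixes \<alpha> :: real
  assumes \<alpha>: "0 \<le> \<alpha>" "\<alpha> \<le> 1" and hr: "h < k" "r < D"
  shows "pagerank \<alpha> hard_graph (Tgt h r) \<le> 3 / card hard_verts"
proof -
  have point: "(\<Sum>s\<in>hard_verts. of_bool (s = u) :: real) \<le> 1" for u
    by (simp add: of_bool_def sum.delta)
  have "card (hard_verts \<inter> (\<lambda>l. Feeder l) ` {..<k}) \<le> card ((\<lambda>l. Feeder l) ` {..<k})"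
    by (intro card_mono) auto
  also have "\<dots> \<le> k" using card_image_le[of "{..<k}"] by simp
  finally have feed: "(\<Sum>s\<in>hard_verts. of_bool (s \<in> (\<lambda>l. Feeder l) ` {..<k}) :: real) \<le> k"
    by (simp add: of_bool_def sum.If_cases)
  have "(\<Sum>s\<in>hard_verts. ppr \<alpha> hard_graph s (Tgt h r)) \<le> (\<Sum>s\<in>hard_verts. potential h r s)"
    using ppr_hard_graph_le[OF \<alpha> hr] by (rule sum_mono)
  also have "\<dots> = (\<Sum>s\<in>hard_verts. of_bool (s = Tgt h r)) + (\<Sum>s\<in>hard_verts. of_bool (s = Hub h)) / D
     + (\<Sum>s\<in>hard_verts. of_bool (s \<in> (\<lambda>l. Feeder l) ` {..<k})) / (k * D)"
    by (simp only: potential_def sum.distrib sum_divide_distrib)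
  also have "\<dots> \<le> 1 + 1 / D + k / (k * D)"
    by (intro add_mono divide_right_mono point feed) auto
  also have "\<dots> \<le> 3"
    using k D by (simp add: field_simps)
  finally show ?thesis
    by (simp add: pagerank_def divide_right_mono)
qed

definition swapped :: "nat \<Rightarrow> nat \<Rightarrow> nat \<Rightarrow> nat pair_pre_digraph" where
  "swapped h j l = \<lparr>pverts = hard_verts,
     parcs = swap_arcs hard_arcs (Mid (mid j)) (Sink j) (Feeder l) (Hub h)\<rparr>"

lemma arc_swap_swapped:
  assumes "h < k" "j < k" "l < k"
  shows "arc_swap hard_graph (Mid (mid j)) (Sink j) (Feeder l) (Hub h) (swapped h j l)"
  using assms input_graph_hard_graph
  by unfold_locales (auto simp: swapped_def hard_arcs_def)

text \<open>The swap opens a route from the middle node to the hub. Each source above that node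
  reaches the target along it, with the walk splitting first over the out-neighbours of the middle
  node and then over \<open>D\<close> targets. The number of such sources compensates for both
  splits, leaving the factor \<open>K\<close>.\<close>

lemma pagerank_swapped_ge:
  fixes \<alpha> :: real
  assumes \<alpha>: "0 \<le> \<alpha>" "\<alpha> \<le> 1" and hr: "h < k" "r < D" and jl: "j < k" "l < k"
  shows "K * ((1 - \<alpha>) ^ 3 * \<alpha>) / card hard_verts \<le> pagerank \<alpha> (swapped h j l) (Tgt h r)"
proof -
  interpret arc_swap hard_graph "Mid (mid j)" "Sink j" "Feeder l" "Hub h" "swapped h j l"
    using hr jl by (intro arc_swap_swapped)
  \<comment> \<open>The indices sharing the middle node of \<open>j\<close>: only \<open>j\<close>
    with \<open>With_Adj\<close>, all \<open>k\<close> of them with \<open>With_In_Sorted\<close>.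
    Their number cancels, so both models get the same bound.\<close>
  define J where "J = {j'. j' < k \<and> mid j' = mid j}"
  have J: "finite J" "card J > 0" using jl by (auto simp: J_def card_gt_0_iff)
  define S where "S = (\<lambda>(j', r'). Src j' r') ` (J \<times> {..<K * D})"
  have cardS: "card S = card J * (K * D)"
    unfolding S_def by (subst card_image) (auto simp: inj_on_def card_cartesian_product)
  have ppr: "(1 - \<alpha>) ^ 3 * \<alpha> / (card J * D) \<le> ppr \<alpha> (swapped h j l) s (Tgt h r)" if "s \<in> S" for s
  proof -
    from that obtain j' r' where s: "s = Src j' r'" "j' < k" "mid j' = mid j" "r' < K * D"
      by (auto simp: S_def J_def)
    have "card (hard_arcs `` {s}) = 1" "card (hard_arcs `` {Mid (mid j)}) = card J"
      "card (hard_arcs `` {Hub h}) = D"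
      using s hr hard_arcs_Image(2)[of "mid j", folded J_def]
      by (simp_all add: hard_arcs_Image(1,5) card_image inj_on_def del: One_nat_def)
    moreover have "(s, Mid (mid j)) \<in> parcs (swapped h j l)"
      "(Mid (mid j), Hub h) \<in> parcs (swapped h j l)" "(Hub h, Tgt h r) \<in> parcs (swapped h j l)"
      "finite (parcs (swapped h j l))"
      using s hr by (auto simp: swapped_def swap_arcs_def hard_arcs_def image_iff Bex_def)
    ultimately show ?thesis
      using ppr_path3[OF \<alpha>, of "swapped h j l" s "Mid (mid j)" "Hub h" "Tgt h r"]
      by (simp add: card_out_swap)
  qed
  have "K * ((1 - \<alpha>) ^ 3 * \<alpha>) = (\<Sum>s\<in>S. (1 - \<alpha>) ^ 3 * \<alpha> / (card J * D))"
    using J D by (auto simp: cardS)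
  also have "\<dots> \<le> (\<Sum>s\<in>S. ppr \<alpha> (swapped h j l) s (Tgt h r))"
    by (intro sum_mono ppr)
  also have "\<dots> \<le> (\<Sum>s\<in>hard_verts. ppr \<alpha> (swapped h j l) s (Tgt h r))"
    by (intro sum_mono2) (auto simp: ppr_nonneg S_def J_def hard_verts_def)
  finally show ?thesis
    by (simp add: pagerank_def divide_right_mono swapped_def)
qed

text \<open>A probed arc that betrays a swap determines \<open>j\<close> or \<open>l\<close>. At
  most \<open>k\<close> pairs share a given \<open>j\<close>, and at most \<open>k\<close> a given
  \<open>l\<close>.\<close>

lemma card_detected_le:
  assumes "allowed X q" and h: "h < k"
  shows "card {(j, l) \<in> {..<k} \<times> {..<k}.
    answer (swapped h j l) (swap_lists X hard_graph L (Mid (mid j)) (Sink j) (Feeder l) (Hub h)) q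
      \<noteq> answer hard_graph L q} \<le> 2 * k" (is "card ?I \<le> _")
proof -
  obtain x y where xy: "probed_arc L q = (x, y)" by fastforce
  \<comment> \<open>With \<open>With_Adj\<close> the probe may be the new arc into the hub, whose
    head says nothing about \<open>j\<close>, so \<open>j\<close> is read off the tail. With
    \<open>With_In_Sorted\<close> all swaps share one middle node, but only the old arc into the
    sink can be probed, and its head reveals \<open>j\<close>.\<close>
  define A where "A = {j \<in> {..<k}. if X = With_Adj then Mid (mid j) = x else Sink j = y}"
  define B where "B = {l \<in> {..<k}. Feeder l = x}"
  have "card A \<le> 1" "card B \<le> 1"
    unfolding A_def B_def mid_def by (auto simp: card_le_Suc0_iff_eq)
  have "?I \<subseteq> A \<times> {..<k} \<union> {..<k} \<times> B"
  proof (clarify, goal_cases)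
    case (1 j l)
    then interpret arc_swap hard_graph "Mid (mid j)" "Sink j" "Feeder l" "Hub h" "swapped h j l"
      using h by (intro arc_swap_swapped) auto
    have "(x, y) \<in> {(Mid (mid j), Sink j), (Feeder l, Hub h)} \<or>
        X = With_Adj \<and> (x, y) \<in> {(Mid (mid j), Hub h), (Feeder l, Sink j)}"
      using answer_swap_cases[OF assms(1), of L] 1 unfolding xy by blast
    then have "j \<in> A \<or> l \<in> B"
      using 1 unfolding A_def B_def by (cases "X = With_Adj") auto
    then show ?case using 1 by blast
  qed
  then have "card ?I \<le> card (A \<times> {..<k} \<union> {..<k} \<times> B)"
    by (intro card_mono) (auto simp: A_def B_def)
  also have "\<dots> \<le> card A * k + k * card B"
    by (rule order.trans[OF card_Un_le]) (simp add: card_cartesian_product)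
  also have "\<dots> \<le> 1 * k + k * 1"
    by (intro add_mono mult_mono \<open>card A \<le> 1\<close> \<open>card B \<le> 1\<close>) auto
  finally show ?thesis by simp
qed

context
  fixes \<alpha> \<epsilon> p\<^sub>f :: real and L :: adj_lists and A :: algorithm
  assumes \<alpha>: "0 \<le> \<alpha>" "\<alpha> \<le> 1" and \<epsilon>: "0 < \<epsilon>" "\<epsilon> < 1" and pf: "p\<^sub>f < 1 / 2"
    and K: "(1 + \<epsilon>) * 3 \<le> (1 - \<epsilon>) * (K * ((1 - \<alpha>) ^ 3 * \<alpha>))"
    and L: "adj_lists_of hard_graph L" and model: "in_model X A"
    and solves: "solves_single_node \<alpha> \<epsilon> p\<^sub>f A"
begin

text \<open>There are \<open>k * k\<close> alternatives and a query separates at most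
  \<open>2 * k\<close> of them from the hard graph; the quotient is \<open>k / 2\<close>.\<close>

lemma expected_time_hard_graph_ge:
  assumes hr: "h < k" "r < D"
  shows "ennreal ((1 - 2 * p\<^sub>f) * k / 2) \<le> expected_time hard_graph L A (Tgt h r)"
proof -
  let ?t = "Tgt h r" and ?I = "{..<k} \<times> {..<k}"
  let ?G = "\<lambda>(j, l). swapped h j l"
  let ?L = "\<lambda>(j, l). swap_lists X hard_graph L (Mid (mid j)) (Sink j) (Feeder l) (Hub h)"
  have t: "?t \<in> hard_verts" using hr by (auto simp: hard_verts_def)
  have succ: "1 - p\<^sub>f \<le> success_prob \<alpha> \<epsilon> G L A ?t"
    if "input_graph G" "adj_lists_of G L" "?t \<in> pverts G" for G L
    using solves that unfolding solves_single_node_def by fastforce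
  have "of_nat (card ?I) * ennreal (1 - 2 * p\<^sub>f) \<le> of_nat (2 * k) * expected_time hard_graph L A ?t"
  proof (rule expected_time_lower_bound[where G' = ?G and L' = ?L and \<alpha> = \<alpha> and \<epsilon> = \<epsilon>])
    show "1 - p\<^sub>f \<le> success_prob \<alpha> \<epsilon> hard_graph L A ?t"
      using succ[OF input_graph_hard_graph L] t by simp
  next
    fix i assume "i \<in> ?I"
    then obtain j l where i: "i = (j, l)" and jl: "j < k" "l < k" by auto
    interpret arc_swap hard_graph "Mid (mid j)" "Sink j" "Feeder l" "Hub h" "swapped h j l"
      using hr jl by (intro arc_swap_swapped)
    show "card (pverts (?G i)) = card (pverts hard_graph)"
      by (simp add: i swapped_def)
    have "card (hard_arcs `` {Mid (mid j)}) = card (hard_arcs `` {Feeder l})" if "X = With_In_Sorted"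
    proof -
      have "mid j' = 0" for j' unfolding mid_def using that by simp
      then show ?thesis using jl by (simp add: hard_arcs_Image card_image inj_on_def)
    qed
    then have "adj_lists_of (?G i) (?L i)"
      using adj_lists_of_swap[OF L] by (simp add: i)
    then show "1 - p\<^sub>f \<le> success_prob \<alpha> \<epsilon> (?G i) (?L i) A ?t"
      using succ input_graph_swap t by (simp add: i swapped_def)
    have "(1 + \<epsilon>) * pagerank \<alpha> hard_graph ?t \<le> (1 + \<epsilon>) * (3 / card hard_verts)"
      using pagerank_hard_graph_le[OF \<alpha> hr] \<epsilon> by (intro mult_left_mono) auto
    also have "\<dots> \<le> (1 - \<epsilon>) * (K * ((1 - \<alpha>) ^ 3 * \<alpha>) / card hard_verts)"
      using divide_right_mono[OF K, of "card hard_verts"] by simp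
    also have "\<dots> \<le> (1 - \<epsilon>) * pagerank \<alpha> (swapped h j l) ?t"
      using pagerank_swapped_ge[OF \<alpha> hr jl] \<epsilon> by (intro mult_left_mono) auto
    finally show "(1 + \<epsilon>) * pagerank \<alpha> hard_graph ?t \<le> (1 - \<epsilon>) * pagerank \<alpha> (?G i) ?t"
      by (simp add: i)
  next
    fix H q assume "A (card (pverts hard_graph)) ?t H = Query q"
    then have "allowed X q" using model by (auto simp: in_model_def)
    from card_detected_le[OF this hr(1), of L]
    show "card {i \<in> ?I. answer (?G i) (?L i) q \<noteq> answer hard_graph L q} \<le> 2 * k"
      by (simp add: case_prod_beta' mem_Times_iff conj_assoc)
  qed simp
  then show ?thesis
  \<comment> \<open>For finite time the factor \<open>2 * k\<close> is cancelled in the reals; for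
    infinite time the bound is trivial.\<close>
  proof (cases "expected_time hard_graph L A ?t")
    case (real x)
    have "of_nat (card ?I) * ennreal (1 - 2 * p\<^sub>f) = ennreal (real (k * k) * (1 - 2 * p\<^sub>f))"
      using pf by (simp add: ennreal_mult ennreal_of_nat_eq_real_of_nat)
    moreover have "of_nat (2 * k) * ennreal x = ennreal (real (2 * k) * x)"
      using real(1) by (simp add: ennreal_mult ennreal_of_nat_eq_real_of_nat del: of_nat_mult)
    ultimately have "real (k * k) * (1 - 2 * p\<^sub>f) \<le> real (2 * k) * x"
      using \<open>of_nat (card ?I) * _ \<le> _\<close> real by (simp add: ennreal_le_iff del: of_nat_mult)
    then have "(1 - 2 * p\<^sub>f) * k / 2 \<le> x"
      using k by (simp add: mult.assoc mult.left_commute) (simp add: mult.commute)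
    then show ?thesis by (simp add: real ennreal_leI)
  qed simp
qed

text \<open>The \<open>k * D\<close> targets make up at least a fraction 1 over \<open>K + 5\<close>
  of all nodes, and the time spent on other nodes is dropped.\<close>

lemma average_time_hard_graph_ge:
  "ennreal ((1 - 2 * p\<^sub>f) / (2 * (K + 5)) * k) \<le> average_time hard_graph L A"
proof -
  let ?T = "(\<lambda>(h, r). Tgt h r) ` ({..<k} \<times> {..<D})"
  define x where "x = (1 - 2 * p\<^sub>f) * k / 2"
  have x: "0 \<le> x" using pf by (simp add: x_def)
  have cardT: "card ?T = k * D"
    by (subst card_image) (auto simp: inj_on_def)
  have N: "0 < card hard_verts" using card_hard_verts_ge k D by (metis less_le_trans mult_pos_pos)
  have "card hard_verts \<le> (K + 5) * (k * D)"
  proof -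
    have "k * (K * D) + 4 * k + k * D \<le> k * (K * D) + 4 * (k * D) + k * D" using D by simp
    also have "\<dots> = (K + 5) * (k * D)" by (simp add: algebra_simps)
    finally show ?thesis using card_hard_verts_le le_trans by blast
  qed
  then have le: "real (card hard_verts) \<le> real (k * D) * real (K + 5)"
    by (metis mult.commute of_nat_le_iff of_nat_mult)
  have "(1 - 2 * p\<^sub>f) / (2 * (K + 5)) * k = real (k * D) * x / (real (k * D) * real (K + 5))"
    using k D by (subst mult_divide_mult_cancel_left) (simp_all add: x_def)
  also have "\<dots> \<le> real (k * D) * x / card hard_verts"
    using le N x by (intro divide_left_mono mult_nonneg_nonneg mult_pos_pos) (use k D in auto)
  finally have "ennreal ((1 - 2 * p\<^sub>f) / (2 * (K + 5)) * k) \<le> ennreal (real (k * D) * x / card hard_verts)"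
    by (rule ennreal_leI)
  also have "\<dots> = (\<Sum>t\<in>?T. ennreal x) / of_nat (card hard_verts)"
    using N x by (simp add: cardT divide_ennreal ennreal_mult[symmetric] ennreal_of_nat_eq_real_of_nat del: of_nat_mult)
  also have "(\<Sum>t\<in>?T. ennreal x) \<le> (\<Sum>t\<in>?T. expected_time hard_graph L A t)"
    using expected_time_hard_graph_ge by (intro sum_mono) (auto simp: x_def)
  also have "\<dots> \<le> (\<Sum>t\<in>hard_verts. expected_time hard_graph L A t)"
    by (intro sum_mono2) (auto simp: hard_verts_def)
  finally show ?thesis
    by (simp add: average_time_def divide_right_mono_ennreal)
qed

end

end


section \<open>The lower bound\<close>

theorem theorem6p8:
  fixes \<alpha> \<epsilon> p\<^sub>f :: real and X :: extra_query
  assumes "0 < \<alpha>" "\<alpha> < 1"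
    and "0 < \<epsilon>" "\<epsilon> < 1"
    and "0 < p\<^sub>f" "p\<^sub>f < 1 / 2"
  shows "\<exists>a b c :: real. 0 < a \<and> 0 < b \<and> 0 < c \<and>
    (\<forall>n m :: nat. 1 \<le> n \<and> n \<le> m \<and> m \<le> n ^ 2 \<longrightarrow>
      (\<exists>G. input_graph G \<and>
        a * real n \<le> real (card (pverts G)) \<and> real (card (pverts G)) \<le> b * real n \<and>
        a * real m \<le> real (card (parcs G)) \<and> real (card (parcs G)) \<le> b * real m \<and>
        (\<forall>L A. adj_lists_of G L \<and> in_model X A \<and> solves_single_node \<alpha> \<epsilon> p\<^sub>f A \<longrightarrow>
          ennreal (c * sqrt (real m)) \<le> average_time G L A)))"
proof -
  \<comment> \<open>\<open>K\<close> makes the swap raise the PageRank of a target, whose weight is at most \<open>3\<close> before,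
    by the factor \<open>(1 + \<epsilon>) / (1 - \<epsilon>)\<close> that separates the two sets of admissible outputs.\<close>
  define K where "K = nat \<lceil>(1 + \<epsilon>) * 3 / ((1 - \<epsilon>) * ((1 - \<alpha>) ^ 3 * \<alpha>))\<rceil>"
  have pos: "0 < (1 - \<epsilon>) * ((1 - \<alpha>) ^ 3 * \<alpha>)" using assms by simp
  have "(1 + \<epsilon>) * 3 / ((1 - \<epsilon>) * ((1 - \<alpha>) ^ 3 * \<alpha>)) \<le> real K"
    unfolding K_def by (rule real_nat_ceiling_ge)
  then have K: "(1 + \<epsilon>) * 3 \<le> (1 - \<epsilon>) * (K * ((1 - \<alpha>) ^ 3 * \<alpha>))"
    using pos by (simp add: pos_divide_le_eq mult.left_commute)
  define c where "c = (1 - 2 * p\<^sub>f) / (4 * (K + 5))"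
  have c: "0 < c" using assms by (simp add: c_def)
  \<comment> \<open>The witness \<open>1 / 4\<close> comes from \<open>m \<le> 4 * k * k\<close>, as
    \<open>k\<close> is the rounded-down root. The witness \<open>2 * K + 7\<close> comes from the
    arc count: \<open>2 * K\<close> for the sources, 2 for middle nodes and sinks, 1 for feeders and
    4 for hubs and targets.\<close>
  show ?thesis
  proof (rule exI[of _ "1 / 4"], rule exI[of _ "real (2 * K + 7)"], rule exI[of _ c], intro conjI allI impI)
    fix n m :: nat assume nm: "1 \<le> n \<and> n \<le> m \<and> m \<le> n ^ 2"
    define k where "k = nat \<lfloor>sqrt (real m)\<rfloor>"
    \<comment> \<open>Rounding up ensures \<open>n \<le> k * D\<close>; the excess is at most
      \<open>k\<close>, and \<open>k \<le> n\<close> because \<open>m \<le> n ^ 2\<close>, so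
      \<open>k * D \<le> 2 * n\<close>.\<close>
    define D where "D = n div k + 1"
    have "1 \<le> sqrt (real m)" using nm by simp
    then have k: "real k \<le> sqrt (real m)" "sqrt (real m) < real k + 1" "1 \<le> k"
      unfolding k_def by linarith+
    then have sqrt_le: "sqrt (real m) \<le> 2 * real k" by linarith
    have "real k ^ 2 \<le> real m"
      using power_mono[OF k(1), of 2] by simp
    then have kk: "k ^ 2 \<le> m" by (metis of_nat_le_iff of_nat_power)
    have "real m \<le> (2 * real k) ^ 2"
      using power_mono[OF sqrt_le, of 2] by simp
    then have m_le: "real m \<le> 4 * real (k * k)" by (simp add: power2_eq_square)
    have "k ^ 2 \<le> n ^ 2" using kk nm by linarith
    then have kn: "k \<le> n" by (simp add: power2_nat_le_eq_le)
    have "n = k * (n div k) + n mod k" "n mod k < k" using k(3) by simp_all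
    moreover have "k * D = k * (n div k) + k" by (simp add: D_def algebra_simps)
    ultimately have kD: "n \<le> k * D" "k * D \<le> 2 * n"
      using kn by linarith+
    interpret hard_instance k D K X
      using k(3) by unfold_locales (auto simp: D_def)
    have kKD: "k * (K * D) \<le> 2 * (K * n)"
      using mult_le_mono2[OF kD(2), of K] by (simp add: mult.left_commute)
    have "card hard_verts \<le> 2 * (K * n) + 6 * n"
      using card_hard_verts_le kKD kD kn by linarith
    also have "\<dots> \<le> (2 * K + 7) * n" by (simp add: algebra_simps)
    finally have V: "real (card hard_verts) \<le> real (2 * K + 7) * real n"
      by (metis of_nat_le_iff of_nat_mult)
    have "card hard_arcs \<le> 2 * (K * n) + 2 * n + m + 4 * n"
      using card_hard_arcs_le kKD kD kn kk[unfolded power2_eq_square] by linarith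
    \<comment> \<open>This is where \<open>n \<le> m\<close> enters: arcs counted in terms of
      \<open>n\<close> are charged to \<open>m\<close>.\<close>
    also have "\<dots> \<le> 2 * (K * m) + 2 * m + m + 4 * m"
      using nm by (intro add_mono mult_le_mono order.refl) auto
    also have "\<dots> = (2 * K + 7) * m" by (simp add: algebra_simps)
    finally have E: "real (card hard_arcs) \<le> real (2 * K + 7) * real m"
      by (metis of_nat_le_iff of_nat_mult)
    have V': "1 / 4 * real n \<le> real (card hard_verts)"
      using card_hard_verts_ge kD(1) by simp
    have E': "1 / 4 * real m \<le> real (card hard_arcs)"
      using m_le card_hard_arcs_ge by linarith
    have time: "ennreal (c * sqrt (real m)) \<le> average_time hard_graph L A"
      if "adj_lists_of hard_graph L \<and> in_model X A \<and> solves_single_node \<alpha> \<epsilon> p\<^sub>f A" for L A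
    proof -
      \<comment> \<open>The 4 in the denominator of \<open>c\<close>, instead of 2, absorbs the loss
        from rounding the root down to \<open>k\<close>.\<close>
      have "c * sqrt (real m) \<le> c * (2 * real k)"
        using sqrt_le c by (intro mult_left_mono) auto
      also have "\<dots> = (1 - 2 * p\<^sub>f) / (2 * (K + 5)) * k"
        by (simp add: c_def field_simps)
      finally have "ennreal (c * sqrt (real m)) \<le> ennreal ((1 - 2 * p\<^sub>f) / (2 * (K + 5)) * k)"
        by (rule ennreal_leI)
      also have "\<dots> \<le> average_time hard_graph L A"
        using that assms K by (intro average_time_hard_graph_ge) auto
      finally show ?thesis .
    qed
    show "\<exists>G. input_graph G \<and>
        1 / 4 * real n \<le> real (card (pverts G)) \<and> real (card (pverts G)) \<le> real (2 * K + 7) * real n \<and>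
        1 / 4 * real m \<le> real (card (parcs G)) \<and> real (card (parcs G)) \<le> real (2 * K + 7) * real m \<and>
        (\<forall>L A. adj_lists_of G L \<and> in_model X A \<and> solves_single_node \<alpha> \<epsilon> p\<^sub>f A \<longrightarrow>
          ennreal (c * sqrt (real m)) \<le> average_time G L A)"
      by (rule exI[of _ hard_graph]) (use input_graph_hard_graph V V' E E' time in simp)
  qed (use c in auto)
qed

end
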